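(* For every $s\in\mathbb{N}$ there exists an infinite sequence of integers $n_1<m_1<n_2<m_2<\cdots$ (with $n_1\geq 2$) such that $$|A_{n_k}\cap A_{m_k}|=s\qquad\text{for all } k=1,2,\dots$$
   Context: For an integer $k\geq 2$, let $A_k=\{r(k-r): r\in\mathbb{Z},\ 1\leq r\leq k-1\}$ (a set of integers, so repeated values are counted once). $\mathbb{N}=\{0,1,2,\dots\}$ denotes the set of non-negative integers, and $|X|$ denotes the cardinality of a finite set $X$. *)

theory Defs
  imports Main
begin

text \<open>Only arguments \<open>k \<ge> 2\<close> are meaningful; for \<open>k < 2\<close> the set is empty.\<close>

definition A :: "int \<Rightarrow> int set" where
  "A k = {r * (k - r) | r. 1 \<le> r \<and> r \<le> k - 1}"

lemma finite_A: "finite (A k)"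
proof -
  have "A k = (\<lambda>r. r * (k - r)) ` {1..k - 1}"
    unfolding A_def by auto
  then show ?thesis by simp
qed

end

theory Submission
  imports Defs "HOL-Computational_Algebra.Primes"
begin

text \<open>
  Completing the square, a common value \<open>r (n - r) = u (m - u)\<close> is the same thing as
  a factorization \<open>m\<^sup>2 - n\<^sup>2 = d e\<close> with \<open>m - n < d \<le> e\<close>, where
  \<open>d = (m - 2u) - (n - 2r)\<close> and \<open>e = (m - 2u) + (n - 2r)\<close>. Choosing
  \<open>m - n = 3\<^sup>j\<close> and \<open>m + n = 3\<^sup>j\<^sup>+\<^sup>2\<^sup>s\<^sup>+\<^sup>1\<close>, the admissible divisors are
  \<open>d = 3\<^sup>j\<^sup>+\<^sup>i\<close> with \<open>1 \<le> i \<le> s\<close>, and distinct divisors give distinct values.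
\<close>

text \<open>Writing \<open>3 ^ i\<close> as \<open>2 * g i + 1\<close> turns halves of sums and
  differences of powers of 3 into polynomials in \<open>g\<close>, so later identities need no
  division.\<close>

definition g :: "nat \<Rightarrow> int" where
  "g i = (3 ^ i - 1) div 2"

lemma power3_eq_g: "3 ^ i = 2 * g i + 1"
proof -
  have "odd ((3::int) ^ i)" by simp
  then show ?thesis unfolding g_def by (simp add: odd_two_times_div_two_succ)
qed

lemma g_eq_iff: "g i = g k \<longleftrightarrow> i = k"
proof
  assume "g i = g k"
  then have "(3::int) ^ i = 3 ^ k" by (simp add: power3_eq_g)
  then show "i = k" by simp
qed simp

lemma g_nonneg: "0 \<le> g i"
  using power3_eq_g[of i] one_le_power[of "3::int" i] by linarith

lemma g_pos: "1 \<le> i \<Longrightarrow> 1 \<le> g i"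
  using power3_eq_g[of i] power_increasing[of 1 i "3::int"] by simp

lemma g_add: "g (i + k) = 2 * g i * g k + g i + g k"
proof -
  have "2 * g (i + k) + 1 = (2 * g i + 1) * (2 * g k + 1)"
    using power_add[of "3::int" i k] by (simp only: power3_eq_g)
  then show ?thesis by (simp add: algebra_simps)
qed

text \<open>The symmetry \<open>r \<mapsto> k - r\<close> allows the smaller factor to be chosen,
  which later yields \<open>d \<le> e\<close>.\<close>

lemma A_half:
  assumes "v \<in> A k"
  obtains r where "1 \<le> r" "2 * r \<le> k" "v = r * (k - r)"
proof -
  from assms obtain r where r: "1 \<le> r" "r \<le> k - 1" "v = r * (k - r)"
    unfolding A_def by auto
  show thesis
  proof (cases "2 * r \<le> k")
    case True
    with r that show thesis by blast
  next
    case False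
    with r that[of "k - r"] show thesis by (simp add: mult.commute)
  qed
qed

lemma divisor_prime_power_int:
  fixes d p :: int
  assumes "prime p" "0 < d" "d dvd p ^ N"
  obtains l where "l \<le> N" "d = p ^ l"
proof -
  from divides_primepow_weak[OF assms(1,3)] obtain l where "l \<le> N" "normalize d = normalize (p ^ l)"
    by blast
  with assms prime_gt_0_int[OF assms(1)] that show thesis by simp
qed

text \<open>The common value attached to the divisor \<open>3\<^sup>j\<^sup>+\<^sup>i\<close>, with complementary divisor \<open>3\<^sup>j\<^sup>+\<^sup>k\<close>.\<close>

definition common :: "nat \<Rightarrow> nat \<Rightarrow> nat \<Rightarrow> int" where
  "common j i k = (3 ^ j)\<^sup>2 * (g i * g k * (g i + 1) * (g k + 1))"

text \<open>The four factors pair up in two ways: \<open>g i * (g k + 1)\<close> and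
  \<open>g k * (g i + 1)\<close> add up to \<open>g (i + k)\<close>, while \<open>g i * g k\<close>
  and \<open>(g i + 1) * (g k + 1)\<close> add up to \<open>g (i + k) + 1\<close>.\<close>

lemma common_mem:
  assumes "1 \<le> i" "1 \<le> k"
  shows "common j i k \<in> A (3 ^ j * g (i + k)) \<inter> A (3 ^ j * (g (i + k) + 1))"
proof -
  define a :: int where "a = 3 ^ j"
  have a: "1 \<le> a" unfolding a_def by simp
  note gp = g_pos[OF assms(1)] g_pos[OF assms(2)]
  have pos: "1 \<le> a * (x * y)" if "1 \<le> x" "1 \<le> y" for x y
    using a that by (smt (verit) mult_pos_pos)
  have mem: "a * (x * y) * (a * (z * w)) \<in> A (a * (x * y) + a * (z * w))"
    if "1 \<le> x" "1 \<le> y" "1 \<le> z" "1 \<le> w" for x y z w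
    unfolding A_def using pos[OF that(1,2)] pos[OF that(3,4)]
    by (intro CollectI exI[of _ "a * (x * y)"]) auto
  have "a * (g i * (g k + 1)) * (a * (g k * (g i + 1)))
      \<in> A (a * (g i * (g k + 1)) + a * (g k * (g i + 1)))"
    using gp by (intro mem) auto
  moreover have "a * (g i * g k) * (a * ((g i + 1) * (g k + 1)))
      \<in> A (a * (g i * g k) + a * ((g i + 1) * (g k + 1)))"
    using gp by (intro mem) auto
  ultimately show ?thesis
    unfolding common_def a_def[symmetric] g_add
    by (simp add: algebra_simps power2_eq_square)
qed

lemma common_exhaust:
  fixes s j :: nat
  defines "h \<equiv> g (2 * s + 1)"
  assumes "v \<in> A (3 ^ j * h)" "v \<in> A (3 ^ j * (h + 1))"
  obtains i where "1 \<le> i" "i \<le> s" "v = common j i (2 * s + 1 - i)"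
proof -
  define a :: int where "a = 3 ^ j"
  have a: "1 \<le> a" unfolding a_def by simp
  from A_half[OF assms(2)] obtain r where r: "1 \<le> r" "2 * r \<le> a * h" "v = r * (a * h - r)"
    unfolding a_def by blast
  from A_half[OF assms(3)] obtain u where
    u: "1 \<le> u" "2 * u \<le> a * h + a" "v = u * (a * h + a - u)"
    unfolding a_def by (auto simp: algebra_simps)
  define d e where "d = a + 2 * (r - u)" and "e = a * (2 * h + 1) - 2 * (r + u)"
  \<comment> \<open>With m = \<open>a * h + a\<close>, the map t(m - t) increases up to m/2, so r
    \<le> u would give v = u(m - u) \<ge> r(m - r) = v + ra > v.\<close>
  have "u < r"
  proof (rule ccontr)
    assume "\<not> u < r"
    then have "0 \<le> (u - r) * (a * h + a - u - r)" using r u a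
      by (intro mult_nonneg_nonneg) auto
    moreover have "0 < r * a" using r a by (intro mult_pos_pos) auto
    ultimately show False using r u by (simp add: algebra_simps)
  qed
  then have da: "a < d" unfolding d_def by simp
  have de: "d \<le> e" unfolding d_def e_def using r by (simp add: algebra_simps)
  have "d * e = a * (a * (2 * h + 1)) + 4 * (r * (a * h - r) - u * (a * h + a - u))"
    unfolding d_def e_def by (simp add: algebra_simps)
  also have "\<dots> = a * (a * 3 ^ (2 * s + 1))"
    using r(3) u(3) unfolding h_def power3_eq_g by simp
  also have "\<dots> = 3 ^ (2 * j + (2 * s + 1))"
    unfolding a_def by (simp add: power_add mult_2)
  finally have prod: "d * e = 3 ^ (2 * j + (2 * s + 1))" .
  have "prime (3::int)" by simp
  moreover have "d dvd 3 ^ (2 * j + (2 * s + 1))" unfolding prod[symmetric] by simp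
  moreover have "0 < d" using da a by simp
  ultimately obtain l where l: "l \<le> 2 * j + (2 * s + 1)" "d = 3 ^ l"
    using divisor_prime_power_int by blast
  have "3 ^ l * e = 3 ^ l * 3 ^ (2 * j + (2 * s + 1) - l)"
    using prod l by (simp flip: power_add)
  then have e: "e = 3 ^ (2 * j + (2 * s + 1) - l)" by simp
  have "j < l" using da unfolding a_def l(2) by simp
  then obtain i where i: "l = j + i" "1 \<le> i" by (metis less_imp_add_positive Suc_leI One_nat_def)
  have "l \<le> 2 * j + (2 * s + 1) - l" using de unfolding e l(2) by simp
  \<comment> \<open>The total exponent is odd: 2(j + i) \<le> 2j + 2s + 1 leaves only i \<le>
    s.\<close>
  then have "i \<le> s" unfolding i using l(1) by linarith
  define k where "k = 2 * s + 1 - i"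
  have ik: "2 * s + 1 = i + k" unfolding k_def using \<open>i \<le> s\<close> by simp
  have "2 * j + (2 * s + 1) - l = j + k" unfolding ik i by simp
  then have "e = a * (2 * g k + 1)" unfolding e a_def by (simp add: power_add power3_eq_g[of k])
  moreover have "d = a * (2 * g i + 1)"
    unfolding l(2) i a_def by (simp add: power_add power3_eq_g[of i])
  moreover have h: "h = 2 * g i * g k + g i + g k" unfolding h_def ik g_add ..
  \<comment> \<open>Solve \<open>e - d = 2 * a * h - 4 * r\<close> for \<open>r\<close> and
    substitute for \<open>h\<close>.\<close>
  ultimately have "r = a * (g i * (g k + 1))"
    unfolding d_def e_def by (simp add: algebra_simps)
  then have "v = common j i k"
    unfolding r(3) h common_def a_def[symmetric] by (simp add: algebra_simps power2_eq_square)
  with i(2) \<open>i \<le> s\<close> that show thesis unfolding k_def by blast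
qed

text \<open>Up to the factor \<open>(3 ^ j)\<^sup>2\<close>, the value is w(h + 1 - w) with w =
  \<open>g i * g k\<close>. Since 2w \<le> h, this quadratic determines w. Then \<open>g i\<close>
  and \<open>g k\<close> have known sum and product, so the pair is determined up to order, and i
  \<le> s < k fixes the order.\<close>

lemma inj_on_common: "inj_on (\<lambda>i. common j i (2 * s + 1 - i)) {1..s}"
proof (rule inj_onI)
  fix i i' assume i: "i \<in> {1..s}" and i': "i' \<in> {1..s}"
  define k k' where "k = 2 * s + 1 - i" and "k' = 2 * s + 1 - i'"
  have ik: "i + k = 2 * s + 1" "i' + k' = 2 * s + 1" unfolding k_def k'_def using i i' by auto
  define w w' where "w = g i * g k" and "w' = g i' * g k'"
  define h where "h = g (2 * s + 1)"
  have h: "h = 2 * w + g i + g k" "h = 2 * w' + g i' + g k'"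
    unfolding h_def w_def w'_def using g_add[of i k] g_add[of i' k'] ik by simp_all
  assume "common j i (2 * s + 1 - i) = common j i' (2 * s + 1 - i')"
  then have "w * (g i + 1) * (g k + 1) = w' * (g i' + 1) * (g k' + 1)"
    unfolding common_def k_def[symmetric] k'_def[symmetric] w_def w'_def by simp
  moreover have "(g i + 1) * (g k + 1) = h + 1 - w" "(g i' + 1) * (g k' + 1) = h + 1 - w'"
    using h unfolding w_def w'_def by (simp_all add: algebra_simps)
  ultimately have "w * (h + 1 - w) = w' * (h + 1 - w')" by (simp add: mult.assoc)
  then have "(w - w') * (h + 1 - w - w') = 0" by (simp add: algebra_simps)
  moreover have "0 < h + 1 - w - w'"
    using h g_nonneg[of i] g_nonneg[of k] g_nonneg[of i'] g_nonneg[of k'] by linarith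
  ultimately have ww: "w = w'" by simp
  with h have "g k = g i' + g k' - g i" by linarith
  with ww have "(g i - g i') * (g i - g k') = 0"
    unfolding w_def w'_def by (simp add: algebra_simps)
  then have "i = i' \<or> i = k'" by (simp add: g_eq_iff)
  then show "i = i'" using i i' unfolding k'_def by auto
qed

lemma card_A_Int_A:
  "card (A (3 ^ j * g (2 * s + 1)) \<inter> A (3 ^ j * (g (2 * s + 1) + 1))) = s"
proof -
  have "common j i (2 * s + 1 - i)
      \<in> A (3 ^ j * g (2 * s + 1)) \<inter> A (3 ^ j * (g (2 * s + 1) + 1))" if "i \<in> {1..s}" for i
    using common_mem[of i "2 * s + 1 - i" j] that by (simp add: Suc_diff_le)
  then have "A (3 ^ j * g (2 * s + 1)) \<inter> A (3 ^ j * (g (2 * s + 1) + 1))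
      = (\<lambda>i. common j i (2 * s + 1 - i)) ` {1..s}"
    by (blast elim: common_exhaust intro: atLeastAtMost_iff[THEN iffD2])
  then show ?thesis by (simp only: card_image[OF inj_on_common] card_atLeastAtMost diff_Suc_1)
qed

theorem theorem1p3:
  fixes s :: nat
  shows "\<exists>n m :: nat \<Rightarrow> int. n 1 \<ge> 2 \<and>
    (\<forall>k\<ge>1. n k < m k \<and> m k < n (k + 1)) \<and>
    (\<forall>k\<ge>1. card (A (n k) \<inter> A (m k)) = s)"
proof -
  define h where "h = g (2 * s + 1)"
  \<comment> \<open>The count in \<open>card_A_Int_A\<close> is the same for every exponent
    \<open>j\<close>, so \<open>j\<close> can index the sequence.\<close>
  define n m :: "nat \<Rightarrow> int" where "n k = 3 ^ k * h" and "m k = 3 ^ k * (h + 1)" for k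
  have h: "1 \<le> h" unfolding h_def by (rule g_pos) simp
  then have "2 \<le> n 1" unfolding n_def by simp
  moreover have "n k < m k" for k unfolding n_def m_def by simp
  moreover have "m k < n (k + 1)" for k
  proof -
    \<comment> \<open>Already h = 1, the case s = 0, satisfies h + 1 < 3h.\<close>
    have "3 ^ k * (h + 1) < 3 ^ k * (3 * h)"
      using h by (intro mult_strict_left_mono) auto
    then show ?thesis unfolding n_def m_def by (simp add: mult_ac)
  qed
  moreover have "card (A (n k) \<inter> A (m k)) = s" for k
    unfolding n_def m_def h_def by (rule card_A_Int_A)
  ultimately show ?thesis by blast
qed

end
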